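(* Let $(x^k)_{k\in\mathbb{N}}$ be the sequence generated by $$x^{k+1}=\mathbb{P}_{\mathbb{R}^n_+}\left(x^k-\alpha_k\sum_{i=1}^m\Big[1-\frac{b_i}{\langle a_i,x^k\rangle}\Big]a_i\right)$$ with $x^0\in A^{-1}(\mathbb{R}^m_{++})\cap\mathbb{R}^n_+$, where the step sizes $\alpha_k$ are determined by the Beck–Teboulle line search, for solving the Poisson regularized problem $\min_{x\in\mathbb{R}^n}F_3(x)$. Then the sequences $(x^k)_{k\in\mathbb{N}}$ and $(F_3(x^k))_{k\in\mathbb{N}}$ are Q-linearly convergent to an optimal solution and to the optimal value of this problem, respectively.
   Context: $A\in\mathbb{R}^{m\times n}_+$ is an $m\times n$ matrix with nonnegative entries and nontrivial (nonzero) rows $a_1,\dots,a_m$, and $b\in\mathbb{R}^m_{++}$ has positive entries; $A^{-1}(\mathbb{R}^m_{++})=\{x\in\mathbb{R}^n: Ax\in\mathbb{R}^m_{++}\}$. Put $F_3:=f+g$ with $f(x):=h(Ax)$ and $g:=\delta_{\mathbb{R}^n_+}$ (the indicator function: $0$ on $\mathbb{R}^n_+$, $+\infty$ outside), where $h(y)=\sum_{i=1}^m\big(b_i\log\frac{b_i}{y_i}+y_i-b_i\big)$ if $y\in\mathbb{R}^m_{++}$ and $h(y)=+\infty$ otherwise. $\mathbb{P}_{\mathbb{R}^n_+}$ is the Euclidean projection onto $\mathbb{R}^n_+$. Note that $\nabla f(x)=\sum_{i=1}^m\big[1-\frac{b_i}{\langle a_i,x\rangle}\big]a_i$ for $x\in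 A^{-1}(\mathbb{R}^m_{++})$. Step sizes: fix $\sigma>0$, $\theta\in(0,1)$, and let $J(x,\alpha):=\mathbb{P}_{\mathbb{R}^n_+}(x-\alpha\nabla f(x))$. The Beck–Teboulle line search $LS(x,\sigma',\theta)$ starts with $\alpha=\sigma'$; while $f(J(x,\alpha))>f(x)+\langle\nabla f(x),J(x,\alpha)-x\rangle+\frac{1}{2\alpha}\|x-J(x,\alpha)\|^2$ it replaces $\alpha$ by $\theta\alpha$; it outputs $\alpha$. Set $\alpha_{-1}:=\sigma$ and $\alpha_k:=LS(x^k,\alpha_{k-1},\theta)$ for $k\ge0$. A sequence $(z^k)$ is Q-linearly convergent to $z^*$ if there are $\rho\in(0,1)$ and $K\in\mathbb{N}$ with $\|z^{k+1}-z^*\|\le\rho\|z^k-z^*\|$ for all $k\ge K$. *)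

theory Defs
  imports "HOL-Analysis.Analysis" "HOL-Library.While_Combinator"
begin

definition nonneg_orthant :: "(real ^ 'n) set" where
  "nonneg_orthant = {x. \<forall>i. 0 \<le> x $ i}"

definition pos_orthant :: "(real ^ 'n) set" where
  "pos_orthant = {x. \<forall>i. 0 < x $ i}"

definition indicator_fn :: "'a set \<Rightarrow> 'a \<Rightarrow> ereal" where
  "indicator_fn S x = (if x \<in> S then 0 else \<infinity>)"

definition kl_fn :: "real ^ 'm \<Rightarrow> real ^ 'm \<Rightarrow> ereal" where
  "kl_fn b y = (if y \<in> pos_orthant
     then ereal (\<Sum>i\<in>UNIV. b $ i * ln (b $ i / y $ i) + y $ i - b $ i) else \<infinity>)"

definition poisson_f :: "real ^ 'n ^ 'm \<Rightarrow> real ^ 'm \<Rightarrow> real ^ 'n \<Rightarrow> ereal" where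
  "poisson_f A b x = kl_fn b (A *v x)"

definition poisson_F :: "real ^ 'n ^ 'm \<Rightarrow> real ^ 'm \<Rightarrow> real ^ 'n \<Rightarrow> ereal" where
  "poisson_F A b x = poisson_f A b x + indicator_fn nonneg_orthant x"

text \<open>Gradient of an extended-real-valued function. It is meaningful only at points near which
  the function is finite; there it does not depend on the values that \<^const>\<open>real_of_ereal\<close>
  gives to infinities.\<close>

definition gradient :: "('a::real_inner \<Rightarrow> ereal) \<Rightarrow> 'a \<Rightarrow> 'a" where
  "gradient \<phi> x = (THE D. GDERIV (\<lambda>z. real_of_ereal (\<phi> z)) x :> D)"

definition pg_step :: "('a::euclidean_space \<Rightarrow> ereal) \<Rightarrow> 'a set \<Rightarrow> 'a \<Rightarrow> real \<Rightarrow> 'a" where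
  "pg_step \<phi> C x \<alpha> = closest_point C (x - \<alpha> *\<^sub>R gradient \<phi> x)"

text \<open>The Beck--Teboulle line search. If the loop does not terminate, the value is unspecified.\<close>

definition bt_linesearch ::
    "('a::euclidean_space \<Rightarrow> ereal) \<Rightarrow> 'a set \<Rightarrow> 'a \<Rightarrow> real \<Rightarrow> real \<Rightarrow> real" where
  "bt_linesearch \<phi> C x \<sigma> \<theta> =
     while (\<lambda>\<alpha>. \<phi> (pg_step \<phi> C x \<alpha>) >
              \<phi> x + ereal (gradient \<phi> x \<bullet> (pg_step \<phi> C x \<alpha> - x)
                          + 1 / (2 * \<alpha>) * (norm (x - pg_step \<phi> C x \<alpha>))\<^sup>2))
           (\<lambda>\<alpha>. \<theta> * \<alpha>) \<sigma>"

definition Q_linearly_convergent :: "(nat \<Rightarrow> 'a::real_normed_vector) \<Rightarrow> 'a \<Rightarrow> bool" where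
  "Q_linearly_convergent z l \<longleftrightarrow>
     (\<exists>\<rho> K. 0 < \<rho> \<and> \<rho> < 1 \<and> (\<forall>k\<ge>K. norm (z (Suc k) - l) \<le> \<rho> * norm (z k - l)))"

end

theory Submission
  imports Defs
begin

text \<open>On a sublevel set of the objective the coordinates of \<open>A *v x\<close> lie in a fixed
  interval \<open>[c, M]\<close> with \<open>c > 0\<close>. There the Kullback--Leibler divergence is
  strongly convex and has a quadratic upper model, both with uniform constants. The second
  property keeps the step sizes of the line search bounded away from zero, and the accepted
  steps satisfy the usual three-point inequality of the projected gradient method
  (\<open>projected_gradient_three_point\<close>): the iterates are Fejer monotone with respect to the
  solution set and the objective decreases by a multiple of the squared step length.

  The objective \<open>kl_div b (A *v x)\<close> need not be strongly convex in \<open>x\<close>, and the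
  solution set need not be a single point. It is the polyhedron of all \<open>z \<ge> 0\<close> with
  \<open>A *v z = A *v w\<close> for one minimizer \<open>w\<close>. Strong convexity of the divergence bounds the
  objective gap below by a multiple of \<open>norm (A *v x - A *v w)\<close> squared, and a Hoffman error
  bound (\<open>hoffman_nonneg\<close>) bounds the distance of \<open>x\<close> to the polyhedron by a
  multiple of that norm. So the gap grows quadratically with the distance to the solution set.

  Fejer monotonicity, sufficient decrease and quadratic growth together give Q-linear
  convergence of the values and of the iterates (\<open>Q_linear_from_growth\<close>), with a limit
  in the solution set.\<close>

section \<open>The scalar Kullback--Leibler gap\<close>

lemma ln_gap_nonneg:
  fixes u :: real
  assumes "0 < u"
  shows "0 \<le> u - 1 - ln u"
  using ln_le_minus_one[OF assms] by simp

lemma ln_gap_upper: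
  fixes u :: real
  assumes "0 < u"
  shows "u - 1 - ln u \<le> (u - 1)\<^sup>2 / u"
proof -
  have "ln (1 / u) \<le> 1 / u - 1"
    using assms by (intro ln_le_minus_one) simp
  then have "- ln u \<le> 1 / u - 1"
    using assms by (simp add: ln_div)
  moreover have "(u - 1)\<^sup>2 / u = u - 1 + (1 / u - 1)"
    using assms by (simp add: field_simps power2_eq_square)
  ultimately show ?thesis by linarith
qed

text \<open>In terms of \<open>v = sqrt s\<close> and \<open>w = sqrt t\<close>, the tangent bound for \<open>ln\<close>
  applied to \<open>v / w\<close>, instead of \<open>s / t\<close>, leaves the square \<open>(v / w - 1)\<^sup>2\<close>
  as a lower bound; it is quadratic in \<open>s - t\<close> because \<open>v + w\<close> is bounded.\<close>

lemma ln_gap_lower: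
  fixes s t M :: real
  assumes "0 < s" "0 < t" "s \<le> M" "t \<le> M"
  shows "(s - t)\<^sup>2 / (4 * M\<^sup>2) \<le> s / t - 1 - ln (s / t)"
proof -
  define v w where "v = sqrt s" and "w = sqrt t"
  have v: "0 < v" "s = v\<^sup>2" and w: "0 < w" "t = w\<^sup>2"
    using assms by (auto simp: v_def w_def)
  have M: "0 < M" using assms by linarith
  have "ln (s / t) = 2 * ln (v / w)"
    using v w by (simp add: ln_div ln_realpow)
  also have "\<dots> \<le> 2 * (v / w - 1)"
    using v w ln_le_minus_one[of "v / w"] by simp
  finally have "ln (s / t) \<le> 2 * (v / w - 1)" .
  moreover have "(v - w)\<^sup>2 / w\<^sup>2 = s / t - 1 - 2 * (v / w - 1)"
    using v w by (simp add: field_simps power2_eq_square)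
  ultimately have 1: "(v - w)\<^sup>2 / w\<^sup>2 \<le> s / t - 1 - ln (s / t)" by linarith
  have "(v + w)\<^sup>2 \<le> 2 * (v\<^sup>2 + w\<^sup>2)"
    using zero_le_power2[of "v - w"] by (simp add: power2_eq_square algebra_simps)
  also have "\<dots> \<le> 4 * M" using assms v w by simp
  finally have "w\<^sup>2 * (v + w)\<^sup>2 \<le> M * (4 * M)"
    using assms M v w by (intro mult_mono) auto
  then have "(v - w)\<^sup>2 * (w\<^sup>2 * (v + w)\<^sup>2) \<le> (v - w)\<^sup>2 * (M * (4 * M))"
    by (rule mult_left_mono) simp
  moreover have "(s - t)\<^sup>2 = (v - w)\<^sup>2 * (v + w)\<^sup>2"
    unfolding v w by (simp add: power2_eq_square algebra_simps)
  ultimately have "(s - t)\<^sup>2 * w\<^sup>2 \<le> (v - w)\<^sup>2 * (4 * M\<^sup>2)"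
    by (simp add: power2_eq_square mult_ac)
  then have "(s - t)\<^sup>2 / (4 * M\<^sup>2) \<le> (v - w)\<^sup>2 / w\<^sup>2"
    using M w by (simp add: divide_le_eq le_divide_eq mult_ac)
  with 1 show ?thesis by linarith
qed

text \<open>The logarithm keeps \<open>t\<close> away from zero; the linear term, which dominates
  the logarithm, keeps it bounded.\<close>

lemma kl_sublevel_bounds:
  fixes \<beta> t R :: real
  assumes "0 < \<beta>" "0 < t" "\<beta> * ln (\<beta> / t) + t - \<beta> \<le> R"
  shows "\<beta> * exp (- ((R + \<beta>) / \<beta>)) \<le> t" "t \<le> 2 * (R + \<beta>)"
proof -
  have "ln (\<beta> / t) \<le> (R + \<beta>) / \<beta>"
    using assms by (simp add: field_simps)
  then have "\<beta> / t \<le> exp ((R + \<beta>) / \<beta>)"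
    using assms by (metis divide_pos_pos exp_le_cancel_iff exp_ln)
  then show "\<beta> * exp (- ((R + \<beta>) / \<beta>)) \<le> t"
    using assms by (simp add: exp_minus field_simps)
  \<comment> \<open>The tangent of \<open>ln\<close> at 2 has slope below 1, so half of the linear term survives.\<close>
  have "ln (t / \<beta>) = ln (t / \<beta> / 2) + ln 2"
    using assms by (simp add: ln_div ln_mult)
  also have "\<dots> \<le> (t / \<beta> / 2 - 1) + (2 - 1)"
    using assms by (intro add_mono ln_le_minus_one) auto
  finally have "\<beta> * ln (t / \<beta>) \<le> \<beta> * (t / \<beta> / 2)"
    using assms by (intro mult_left_mono) auto
  then have "\<beta> * ln (t / \<beta>) \<le> t / 2"
    using assms by simp
  moreover have "\<beta> * ln (\<beta> / t) = - (\<beta> * ln (t / \<beta>))"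
    using assms by (simp add: ln_div algebra_simps)
  ultimately show "t \<le> 2 * (R + \<beta>)"
    using assms by argo
qed

section \<open>The Kullback--Leibler divergence on the positive orthant\<close>

definition kl_div :: "real ^ 'm \<Rightarrow> real ^ 'm \<Rightarrow> real" where
  "kl_div b y = (\<Sum>i\<in>UNIV. b $ i * ln (b $ i / y $ i) + y $ i - b $ i)"

definition kl_grad :: "real ^ 'm \<Rightarrow> real ^ 'm \<Rightarrow> real ^ 'm" where
  "kl_grad b y = (\<chi> i. 1 - b $ i / y $ i)"

lemma kl_fn_eq: "y \<in> pos_orthant \<Longrightarrow> kl_fn b y = ereal (kl_div b y)"
  by (simp add: kl_fn_def kl_div_def)

text \<open>The remainder of the first-order expansion depends only on the coordinate ratios, which
  reduces convexity, strong convexity and the upper quadratic model to the scalar gap.\<close>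

lemma kl_bregman:
  fixes b y z :: "real ^ 'm"
  assumes "b \<in> pos_orthant" "y \<in> pos_orthant" "z \<in> pos_orthant"
  shows "kl_div b z - kl_div b y - kl_grad b y \<bullet> (z - y)
       = (\<Sum>i\<in>UNIV. b $ i * (z $ i / y $ i - 1 - ln (z $ i / y $ i)))"
proof -
  have "(b $ i * ln (b $ i / z $ i) + z $ i - b $ i) - (b $ i * ln (b $ i / y $ i) + y $ i - b $ i)
      - (1 - b $ i / y $ i) * (z $ i - y $ i) = b $ i * (z $ i / y $ i - 1 - ln (z $ i / y $ i))" for i
  proof -
    have "0 < b $ i" "0 < y $ i" "0 < z $ i"
      using assms by (auto simp: pos_orthant_def)
    then show ?thesis by (simp add: ln_div field_simps)
  qed
  then show ?thesis
    by (simp add: kl_div_def kl_grad_def inner_vec_def flip: sum_subtractf)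
qed

lemma kl_convex:
  fixes b y z :: "real ^ 'm"
  assumes "b \<in> pos_orthant" "y \<in> pos_orthant" "z \<in> pos_orthant"
  shows "kl_div b y + kl_grad b y \<bullet> (z - y) \<le> kl_div b z"
proof -
  have "0 \<le> (\<Sum>i\<in>UNIV. b $ i * (z $ i / y $ i - 1 - ln (z $ i / y $ i)))"
    using assms by (intro sum_nonneg mult_nonneg_nonneg ln_gap_nonneg)
      (auto simp: pos_orthant_def less_imp_le)
  then show ?thesis using kl_bregman[OF assms] by linarith
qed

lemma norm_sq_cart: "(norm (v :: real ^ 'm))\<^sup>2 = (\<Sum>i\<in>UNIV. (v $ i)\<^sup>2)"
  unfolding power2_norm_eq_inner inner_vec_def by (simp add: power2_eq_square)

lemma kl_strongly_convex:
  fixes b y z :: "real ^ 'm"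
  assumes pos: "b \<in> pos_orthant" "y \<in> pos_orthant" "z \<in> pos_orthant"
    and M: "\<And>i. y $ i \<le> M" "\<And>i. z $ i \<le> M"
    and \<mu>: "\<And>i. \<mu> \<le> b $ i / (4 * M\<^sup>2)"
  shows "kl_div b y + kl_grad b y \<bullet> (z - y) + \<mu> * (norm (z - y))\<^sup>2 \<le> kl_div b z"
proof -
  have "\<mu> * (z $ i - y $ i)\<^sup>2 \<le> b $ i * (z $ i / y $ i - 1 - ln (z $ i / y $ i))" for i
  proof -
    have "\<mu> * (z $ i - y $ i)\<^sup>2 \<le> b $ i / (4 * M\<^sup>2) * (z $ i - y $ i)\<^sup>2"
      by (intro mult_right_mono \<mu>) simp
    also have "\<dots> = b $ i * ((z $ i - y $ i)\<^sup>2 / (4 * M\<^sup>2))" by simp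
    also have "\<dots> \<le> b $ i * (z $ i / y $ i - 1 - ln (z $ i / y $ i))"
      using pos M by (intro mult_left_mono ln_gap_lower) (auto simp: pos_orthant_def less_imp_le)
    finally show ?thesis .
  qed
  then have "\<mu> * (norm (z - y))\<^sup>2 \<le> (\<Sum>i\<in>UNIV. b $ i * (z $ i / y $ i - 1 - ln (z $ i / y $ i)))"
    unfolding norm_sq_cart sum_distrib_left by (intro sum_mono) simp
  then show ?thesis using kl_bregman[OF pos] by linarith
qed

lemma kl_descent:
  fixes b y z :: "real ^ 'm"
  assumes pos: "b \<in> pos_orthant" "y \<in> pos_orthant" "z \<in> pos_orthant"
    and c: "0 < c" "\<And>i. c \<le> y $ i" "\<And>i. c \<le> z $ i"
  shows "kl_div b z \<le> kl_div b y + kl_grad b y \<bullet> (z - y) + norm b / c\<^sup>2 * (norm (z - y))\<^sup>2"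
proof -
  have "b $ i * (z $ i / y $ i - 1 - ln (z $ i / y $ i)) \<le> norm b / c\<^sup>2 * (z $ i - y $ i)\<^sup>2" for i
  proof -
    have p: "0 < b $ i" "0 < y $ i" "0 < z $ i"
      using pos by (auto simp: pos_orthant_def)
    have "z $ i / y $ i - 1 - ln (z $ i / y $ i) \<le> (z $ i / y $ i - 1)\<^sup>2 / (z $ i / y $ i)"
      using p by (intro ln_gap_upper) simp
    also have "\<dots> = (z $ i - y $ i)\<^sup>2 / (y $ i * z $ i)"
      using p by (simp add: field_simps power2_eq_square)
    also have "\<dots> \<le> (z $ i - y $ i)\<^sup>2 / c\<^sup>2"
      using c p unfolding power2_eq_square[of c]
      by (intro divide_left_mono mult_mono mult_pos_pos) (auto simp: less_imp_le)
    finally have "b $ i * (z $ i / y $ i - 1 - ln (z $ i / y $ i))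
        \<le> norm b * ((z $ i - y $ i)\<^sup>2 / c\<^sup>2)"
      using p component_le_norm_cart[of b i] ln_gap_nonneg[of "z $ i / y $ i"]
      by (intro mult_mono) auto
    then show ?thesis by simp
  qed
  then have "(\<Sum>i\<in>UNIV. b $ i * (z $ i / y $ i - 1 - ln (z $ i / y $ i)))
      \<le> norm b / c\<^sup>2 * (norm (z - y))\<^sup>2"
    unfolding norm_sq_cart sum_distrib_left by (intro sum_mono) simp
  then show ?thesis using kl_bregman[OF pos] by linarith
qed

text \<open>All summands of the divergence are nonnegative, so each of them is bounded by
  \<open>R\<close>.\<close>

lemma kl_sublevel_box:
  fixes b :: "real ^ 'm"
  assumes b: "b \<in> pos_orthant"
  obtains c M where "0 < c" "0 < M"
    "\<And>y i. y \<in> pos_orthant \<Longrightarrow> kl_div b y \<le> R \<Longrightarrow> c \<le> y $ i \<and> y $ i \<le> M"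
proof -
  define l where "l i = b $ i * exp (- ((R + b $ i) / b $ i))" for i
  define u where "u i = 2 * (R + b $ i)" for i
  have box: "l i \<le> y $ i \<and> y $ i \<le> u i" if y: "y \<in> pos_orthant" "kl_div b y \<le> R" for y i
  proof -
    have nonneg: "0 \<le> b $ j * ln (b $ j / y $ j) + y $ j - b $ j" for j
    proof -
      have "0 < b $ j" "0 < y $ j" using b y by (auto simp: pos_orthant_def)
      moreover from this have "0 \<le> b $ j * (y $ j / b $ j - 1 - ln (y $ j / b $ j))"
        by (intro mult_nonneg_nonneg ln_gap_nonneg) auto
      ultimately show ?thesis by (simp add: ln_div right_diff_distrib)
    qed
    have "b $ i * ln (b $ i / y $ i) + y $ i - b $ i \<le> kl_div b y"
      unfolding kl_div_def by (rule member_le_sum) (auto intro: nonneg simp del: diff_ge_0_iff_ge)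
    with y have "b $ i * ln (b $ i / y $ i) + y $ i - b $ i \<le> R" by simp
    then show ?thesis
      using kl_sublevel_bounds[of "b $ i" "y $ i" R] b y unfolding l_def u_def pos_orthant_def
      by simp
  qed
  have "0 < Min (range l)"
    using b by (auto simp: l_def pos_orthant_def)
  moreover have "0 < max 1 (Max (range u))" by simp
  moreover have "Min (range l) \<le> y $ i \<and> y $ i \<le> max 1 (Max (range u))"
    if "y \<in> pos_orthant" "kl_div b y \<le> R" for y i
  proof -
    have "Min (range l) \<le> l i" "u i \<le> Max (range u)" by simp_all
    then show ?thesis using box[OF that, of i] by linarith
  qed
  ultimately show ?thesis by (rule that)
qed

section \<open>An error bound for nonnegative solutions of a linear system\<close>

text \<open>By homogeneity and compactness: on the unit vectors of the cone \<open>norm (f v)\<close> attains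
  a minimum, and it is positive.\<close>

lemma cone_kernel_bound:
  fixes f :: "'a::euclidean_space \<Rightarrow> 'b::real_normed_vector"
  assumes lin: "linear f" and K: "closed K" "cone K"
    and ker: "\<And>v. v \<in> K \<Longrightarrow> f v = 0 \<Longrightarrow> v = 0"
  shows "\<exists>\<kappa>\<ge>0. \<forall>v\<in>K. norm v \<le> \<kappa> * norm (f v)"
proof (cases "K \<inter> sphere 0 1 = {}")
  case True
  have "v = 0" if "v \<in> K" for v
  proof (rule ccontr)
    assume "v \<noteq> 0"
    then have "(1 / norm v) *\<^sub>R v \<in> K \<inter> sphere 0 1"
      using K that by (auto simp: cone_def)
    with True show False by blast
  qed
  then show ?thesis by (auto intro!: exI[of _ 0])
next
  case False
  have "compact (K \<inter> sphere 0 1)" using K by (simp add: closed_Int_compact)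
  moreover have "continuous_on (K \<inter> sphere 0 1) (\<lambda>v. norm (f v))"
    by (intro continuous_intros linear_continuous_on linear_conv_bounded_linear[THEN iffD1] lin)
  ultimately obtain w where w: "w \<in> K" "norm w = 1"
      and min: "\<And>v. v \<in> K \<Longrightarrow> norm v = 1 \<Longrightarrow> norm (f w) \<le> norm (f v)"
    using False continuous_attains_inf[of "K \<inter> sphere 0 1" "\<lambda>v. norm (f v)"]
    by (metis IntE IntI mem_sphere_0)
  have m: "0 < norm (f w)" using ker[of w] w by auto
  have "norm v \<le> 1 / norm (f w) * norm (f v)" if v: "v \<in> K" for v
  proof (cases "v = 0")
    case False
    then have "(1 / norm v) *\<^sub>R v \<in> K" "norm ((1 / norm v) *\<^sub>R v) = 1"
      using K v by (auto simp: cone_def)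
    then have "norm (f w) \<le> norm (f ((1 / norm v) *\<^sub>R v))" by (rule min)
    also have "\<dots> = norm (f v) / norm v" by (simp add: linear_scale[OF lin])
    finally show ?thesis using m False by (simp add: field_simps)
  qed simp
  then show ?thesis using m by (intro exI[of _ "1 / norm (f w)"]) auto
qed

definition sign_cone :: "'n set \<Rightarrow> 'n set \<Rightarrow> (real ^ 'n) set" where
  "sign_cone P N = {v. \<forall>i. (i \<in> P \<longrightarrow> 0 \<le> v $ i) \<and> (i \<in> N \<longrightarrow> v $ i \<le> 0)
                          \<and> (i \<notin> P \<union> N \<longrightarrow> v $ i = 0)}"

lemma closed_sign_cone: "closed (sign_cone P N)"
  unfolding sign_cone_def
  by (intro closed_Collect_all closed_Collect_conj closed_Collect_imp closed_Collect_le
      closed_Collect_eq continuous_intros open_Collect_const)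

lemma cone_sign_cone: "cone (sign_cone P N)"
  by (auto simp: cone_def sign_cone_def mult_nonneg_nonpos)

text \<open>If \<open>v\<close> were nonzero, subtracting a small multiple of it from \<open>e\<close> would keep it in
  \<open>S\<close> and shrink every coordinate in which \<open>v\<close> is nonzero.\<close>

lemma min_norm_sign_cone_kernel:
  fixes A :: "real ^ 'n ^ 'm" and d e :: "real ^ 'n"
  defines "S \<equiv> {v. A *v v = A *v d \<and> (\<forall>i. min 0 (d $ i) \<le> v $ i \<and> v $ i \<le> max 0 (d $ i))}"
  assumes e: "e \<in> S" and min: "\<And>v. v \<in> S \<Longrightarrow> norm e \<le> norm v"
    and v: "v \<in> sign_cone {i. 0 < e $ i} {i. e $ i < 0}" "A *v v = 0"
  shows "v = 0"
proof (rule ccontr)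
  assume v0: "v \<noteq> 0"
  \<comment> \<open>\<open>m\<close> is a lower bound for the nonzero coordinates of \<open>e\<close>, so that
    \<open>e - t *\<^sub>R v\<close> has no sign change; the 1 guards against an empty minimum.\<close>
  define m where "m = Min (insert 1 ((\<lambda>i. \<bar>e $ i\<bar>) ` {i. e $ i \<noteq> 0}))"
  have m: "0 < m" "\<And>i. e $ i \<noteq> 0 \<Longrightarrow> m \<le> \<bar>e $ i\<bar>"
    by (auto simp: m_def)
  define t where "t = m / norm v"
  have t: "0 < t" using m v0 by (simp add: t_def)
  have vz: "v $ i = 0" if "e $ i = 0" for i
    using v that by (auto simp: sign_cone_def)
  have small: "\<bar>t * v $ i\<bar> \<le> \<bar>e $ i\<bar>" for i
  proof (cases "e $ i = 0")
    case False
    have "\<bar>t * v $ i\<bar> = m * (\<bar>v $ i\<bar> / norm v)"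
      using m by (simp add: t_def abs_mult)
    also have "\<dots> \<le> m * 1"
      using m v0 component_le_norm_cart[of v i] by (intro mult_left_mono) auto
    finally show ?thesis using m(2)[OF False] by simp
  qed (simp add: vz)
  have sgn: "0 < e $ i \<Longrightarrow> 0 \<le> t * v $ i" "e $ i < 0 \<Longrightarrow> t * v $ i \<le> 0" for i
    using v t by (auto simp: sign_cone_def mult_nonneg_nonpos)
  have "e - t *\<^sub>R v \<in> S"
  proof -
    have "A *v (e - t *\<^sub>R v) = A *v d"
      using e v by (simp add: S_def matrix_vector_mult_diff_distrib matrix_vector_mult_scaleR)
    moreover have "min 0 (d $ i) \<le> (e - t *\<^sub>R v) $ i \<and> (e - t *\<^sub>R v) $ i \<le> max 0 (d $ i)" for i
    proof -
      have "min 0 (d $ i) \<le> e $ i" "e $ i \<le> max 0 (d $ i)" using e by (auto simp: S_def)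
      then show ?thesis
        using sgn[of i] small[of i] by (cases "e $ i" "0::real" rule: linorder_cases) auto
    qed
    ultimately show ?thesis by (simp add: S_def)
  qed
  then have "norm e \<le> norm (e - t *\<^sub>R v)" by (rule min)
  moreover have "norm (e - t *\<^sub>R v) < norm e"
  proof -
    have "(t * v $ i)\<^sup>2 \<le> e $ i * (t * v $ i)" for i
      using sgn[of i] small[of i] unfolding power2_eq_square
      by (cases "e $ i" "0::real" rule: linorder_cases)
        (auto intro: mult_right_mono mult_right_mono_neg)
    then have "(norm (t *\<^sub>R v))\<^sup>2 \<le> e \<bullet> (t *\<^sub>R v)"
      unfolding norm_sq_cart inner_vec_def by (auto intro!: sum_mono)
    moreover have "0 < (norm (t *\<^sub>R v))\<^sup>2" using t v0 by simp
    moreover have "(norm (e - t *\<^sub>R v))\<^sup>2 = (norm e)\<^sup>2 - 2 * (e \<bullet> (t *\<^sub>R v)) + (norm (t *\<^sub>R v))\<^sup>2"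
      by (simp only: power2_norm_eq_inner inner_diff_left inner_diff_right) (simp add: inner_commute)
    ultimately have "(norm (e - t *\<^sub>R v))\<^sup>2 < (norm e)\<^sup>2" by linarith
    then show ?thesis by (rule power_less_imp_less_base) simp
  qed
  ultimately show False by simp
qed

text \<open>A Hoffman bound. Among the corrections \<open>e\<close> that lie coordinatewise between 0 and
  \<open>d = z - x\<close> and satisfy \<open>A *v e = A *v d\<close>, take one of least norm. Then
  \<open>x + e\<close> lies between \<open>x\<close> and \<open>z\<close>, so it is nonnegative. By minimality
  the kernel of \<open>A\<close> meets the cone of the sign pattern of \<open>e\<close> only in 0, so
  \<open>norm e\<close> is bounded by \<open>norm (A *v e)\<close> up to a constant of that pattern. There
  are finitely many sign patterns, and \<open>\<kappa>\<close> is the sum of their constants.\<close>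

lemma hoffman_nonneg:
  fixes A :: "real ^ 'n ^ 'm"
  obtains \<kappa> where "0 \<le> \<kappa>"
    "\<And>x z. x \<in> nonneg_orthant \<Longrightarrow> z \<in> nonneg_orthant \<Longrightarrow>
       \<exists>p\<in>nonneg_orthant. A *v p = A *v z \<and> norm (x - p) \<le> \<kappa> * norm (A *v x - A *v z)"
proof -
  let ?bd = "\<lambda>PN k. \<forall>v\<in>sign_cone (fst PN) (snd PN). norm v \<le> k * norm (A *v v)"
  have "\<exists>k. 0 \<le> k \<and> ((\<forall>v\<in>sign_cone (fst PN) (snd PN). A *v v = 0 \<longrightarrow> v = 0) \<longrightarrow> ?bd PN k)" for PN
  proof (cases "\<forall>v\<in>sign_cone (fst PN) (snd PN). A *v v = 0 \<longrightarrow> v = 0")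
    case True
    then show ?thesis
      using cone_kernel_bound[OF matrix_vector_mul_linear[of A] closed_sign_cone cone_sign_cone]
      by blast
  next
    case False
    then show ?thesis by blast
  qed
  then obtain k where k: "\<And>PN. 0 \<le> k PN"
    and bd: "\<And>PN. \<forall>v\<in>sign_cone (fst PN) (snd PN). A *v v = 0 \<longrightarrow> v = 0 \<Longrightarrow> ?bd PN (k PN)"
    by metis
  define \<kappa> where "\<kappa> = (\<Sum>PN\<in>UNIV. k PN)"
  have "0 \<le> \<kappa>" unfolding \<kappa>_def by (intro sum_nonneg k)
  moreover have "\<exists>p\<in>nonneg_orthant. A *v p = A *v z \<and> norm (x - p) \<le> \<kappa> * norm (A *v x - A *v z)"
    if x: "x \<in> nonneg_orthant" and z: "z \<in> nonneg_orthant" for x z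
  proof -
    define d where "d = z - x"
    define S where "S = {v. A *v v = A *v d \<and> (\<forall>i. min 0 (d $ i) \<le> v $ i \<and> v $ i \<le> max 0 (d $ i))}"
    have "S = {v. A *v v = A *v d} \<inter> cbox (\<chi> i. min 0 (d $ i)) (\<chi> i. max 0 (d $ i))"
      by (auto simp: S_def mem_box_cart)
    moreover have "closed {v. A *v v = A *v d}"
      by (intro closed_Collect_eq continuous_intros linear_continuous_on
          linear_conv_bounded_linear[THEN iffD1] matrix_vector_mul_linear)
    ultimately have "compact S" by (simp add: closed_Int_compact)
    moreover have "d \<in> S" by (auto simp: S_def)
    ultimately obtain e where e: "e \<in> S" and min: "\<And>v. v \<in> S \<Longrightarrow> norm e \<le> norm v"
      using continuous_attains_inf[of S norm] continuous_on_norm_id by blast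
    let ?PN = "({i. 0 < e $ i}, {i. e $ i < 0})"
    have "?bd ?PN (k ?PN)"
      using min_norm_sign_cone_kernel[of e A d] e min unfolding S_def by (intro bd) auto
    moreover have "e \<in> sign_cone (fst ?PN) (snd ?PN)" by (auto simp: sign_cone_def)
    ultimately have "norm e \<le> k ?PN * norm (A *v e)" by blast
    also have "\<dots> \<le> \<kappa> * norm (A *v e)"
      unfolding \<kappa>_def by (intro mult_right_mono member_le_sum k) auto
    also have "A *v e = A *v z - A *v x"
      using e by (simp add: S_def d_def matrix_vector_mult_diff_distrib)
    finally have "norm e \<le> \<kappa> * norm (A *v x - A *v z)" by (simp add: norm_minus_commute)
    moreover have "A *v (x + e) = A *v z"
      using e by (simp add: S_def d_def matrix_vector_mult_diff_distrib matrix_vector_right_distrib)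
    moreover have "x + e \<in> nonneg_orthant"
    proof -
      have "0 \<le> x $ i + e $ i" for i
      proof -
        have "min 0 (z $ i - x $ i) \<le> e $ i" using e by (auto simp: S_def d_def)
        moreover have "0 \<le> x $ i" "0 \<le> z $ i" using x z by (auto simp: nonneg_orthant_def)
        ultimately show ?thesis by linarith
      qed
      then show ?thesis by (simp add: nonneg_orthant_def)
    qed
    ultimately show ?thesis by (intro bexI[of _ "x + e"]) auto
  qed
  ultimately show ?thesis by (rule that)
qed

section \<open>Linear convergence from quadratic growth\<close>

text \<open>Here \<open>r\<close> is the objective gap and \<open>X\<close> the solution set.
  Growth yields a \<open>p\<close> in \<open>X\<close> near \<open>x (Suc k)\<close>; putting it into the
  Fejer inequality bounds \<open>r (Suc k)\<close> by a multiple of the squared step length, hence by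
  descent of a multiple of \<open>r k - r (Suc k)\<close>, which is Q-linear decay of \<open>r\<close>.
  Since the iterates never move away from points of \<open>X\<close>, all later iterates stay as close
  to \<open>p k\<close> as \<open>x k\<close> is; so the iterates converge and their distance to the limit
  is at most twice that to \<open>p k\<close>. The growth condition thus also holds with the limit in
  place of \<open>p k\<close>, and the Fejer inequality at the limit turns it into a contraction.\<close>

lemma Q_linear_from_growth:
  fixes x :: "nat \<Rightarrow> 'a::{real_inner, complete_space}" and r \<alpha> :: "nat \<Rightarrow> real"
  assumes X: "closed X" and a: "0 < a" "\<And>k. a \<le> \<alpha> k" and \<gamma>: "0 < \<gamma>"
    and fejer: "\<And>k p. p \<in> X \<Longrightarrow>
      2 * \<alpha> k * r (Suc k) \<le> (norm (x k - p))\<^sup>2 - (norm (x (Suc k) - p))\<^sup>2"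
    and descent: "\<And>k. 2 * \<alpha> k * (r (Suc k) - r k) \<le> - (norm (x k - x (Suc k)))\<^sup>2"
    and growth: "\<And>k. \<exists>p\<in>X. \<gamma> * (norm (x k - p))\<^sup>2 \<le> r k"
  obtains xs where "xs \<in> X" "Q_linearly_convergent x xs" "Q_linearly_convergent r 0"
proof -
  obtain p where p: "\<And>k. p k \<in> X" and gr: "\<And>k. \<gamma> * (norm (x k - p k))\<^sup>2 \<le> r k"
    using growth by metis
  have r0: "0 \<le> r k" for k
    using gr[of k] \<gamma> by (meson mult_nonneg_nonneg order_trans less_imp_le zero_le_power2)
  have \<alpha>0: "0 < \<alpha> k" for k using a(1) a(2)[of k] by linarith

  define C where "C = 2 * (1 + 1 / (a * \<gamma>))"
  have C: "0 < C" using a \<gamma> by (simp add: C_def add_pos_pos)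
  have rC: "r (Suc k) \<le> C * (r k - r (Suc k))" for k
  proof -
    define d t where "d = norm (x (Suc k) - p (Suc k))" and "t = norm (x k - x (Suc k))"
    have "2 * \<alpha> k * (r k - r (Suc k)) \<ge> t\<^sup>2"
      using descent[of k] by (simp add: t_def algebra_simps)
    then have t2: "t\<^sup>2 / (2 * \<alpha> k) \<le> r k - r (Suc k)"
      using \<alpha>0[of k] by (simp add: field_simps)
    have "norm (x k - p (Suc k)) \<le> t + d"
      unfolding t_def d_def
      using norm_triangle_ineq[of "x k - x (Suc k)" "x (Suc k) - p (Suc k)"] by simp
    then have "(norm (x k - p (Suc k)))\<^sup>2 \<le> (t + d)\<^sup>2" by (rule power_mono) simp
    then have "2 * \<alpha> k * r (Suc k) \<le> (t + d)\<^sup>2 - d\<^sup>2"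
      using fejer[OF p[of "Suc k"], of k] by (simp add: d_def)
    then have 1: "2 * \<alpha> k * r (Suc k) \<le> t\<^sup>2 + 2 * t * d"
      by (simp add: power2_eq_square algebra_simps)
    define s where "s = \<alpha> k * \<gamma>"
    have s: "0 < s" "a * \<gamma> \<le> s" using \<alpha>0[of k] a(2)[of k] \<gamma> by (auto simp: s_def)
    \<comment> \<open>Young's inequality with weight \<open>s\<close>, chosen so that growth absorbs the
      \<open>d\<close> term into half of the left-hand side of \<open>1\<close>.\<close>
    have "0 \<le> (t - s * d)\<^sup>2 / s" using s by simp
    also have "\<dots> = t\<^sup>2 / s - 2 * t * d + s * d\<^sup>2"
      using s by (simp add: field_simps power2_eq_square)
    finally have 2: "2 * t * d \<le> t\<^sup>2 / s + s * d\<^sup>2" by linarith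
    have "s * d\<^sup>2 = \<alpha> k * (\<gamma> * d\<^sup>2)" by (simp add: s_def)
    also have "\<dots> \<le> \<alpha> k * r (Suc k)"
      using gr[of "Suc k"] \<alpha>0[of k] by (intro mult_left_mono) (auto simp: d_def)
    finally have "\<alpha> k * r (Suc k) \<le> t\<^sup>2 + t\<^sup>2 / s" using 1 2 by linarith
    also have "\<dots> = t\<^sup>2 * (1 + 1 / s)" by (simp add: algebra_simps)
    also have "\<dots> \<le> t\<^sup>2 * (1 + 1 / (a * \<gamma>))"
      using s a \<gamma> by (intro mult_left_mono add_left_mono divide_left_mono) auto
    finally have "r (Suc k) \<le> t\<^sup>2 * (1 + 1 / (a * \<gamma>)) / \<alpha> k"
      using \<alpha>0[of k] by (simp add: le_divide_eq mult.commute)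
    also have "\<dots> = C * (t\<^sup>2 / (2 * \<alpha> k))"
    proof -
      have "t\<^sup>2 * E / \<alpha> k = 2 * E * (t\<^sup>2 / (2 * \<alpha> k))" for E by simp
      then show ?thesis unfolding C_def .
    qed
    also have "\<dots> \<le> C * (r k - r (Suc k))"
      using t2 C by (intro mult_left_mono) auto
    finally show ?thesis .
  qed
  define \<rho> where "\<rho> = C / (1 + C)"
  have \<rho>: "0 < \<rho>" "\<rho> < 1" using C by (auto simp: \<rho>_def)
  have rQ: "r (Suc k) \<le> \<rho> * r k" for k
    using rC[of k] C by (simp add: \<rho>_def field_simps)
  then have Qr: "Q_linearly_convergent r 0"
    using \<rho> r0 unfolding Q_linearly_convergent_def by (intro exI[of _ \<rho>] exI[of _ 0]) auto
  have "r k \<le> \<rho> ^ k * r 0" for k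
  proof (induction k)
    case (Suc k)
    then have "\<rho> * r k \<le> \<rho> * (\<rho> ^ k * r 0)" using \<rho> by (intro mult_left_mono) auto
    with rQ[of k] show ?case by simp
  qed simp
  moreover have "(\<lambda>k. \<rho> ^ k * r 0) \<longlonglongrightarrow> 0"
    using \<rho> by (intro tendsto_mult_left_zero LIMSEQ_power_zero) simp
  ultimately have r_lim: "r \<longlonglongrightarrow> 0"
    using r0 by (intro tendsto_sandwich[of "\<lambda>_. 0" r _ "\<lambda>k. \<rho> ^ k * r 0"]) auto

  define \<delta> where "\<delta> k = norm (x k - p k)" for k
  have \<delta>_le: "\<delta> k \<le> sqrt (r k / \<gamma>)" for k
    using gr[of k] \<gamma> by (intro real_le_rsqrt) (simp add: \<delta>_def field_simps)
  have "(\<lambda>k. sqrt (r k / \<gamma>)) \<longlonglongrightarrow> sqrt (0 / \<gamma>)"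
    using \<gamma> by (intro tendsto_intros r_lim) auto
  then have \<delta>_lim: "\<delta> \<longlonglongrightarrow> 0"
    using \<delta>_le by (intro tendsto_sandwich[of "\<lambda>_. 0" \<delta> _ "\<lambda>k. sqrt (r k / \<gamma>)"]) (auto simp: \<delta>_def)
  have mono1: "norm (x (Suc k) - q) \<le> norm (x k - q)" if "q \<in> X" for k q
  proof -
    have "0 \<le> 2 * \<alpha> k * r (Suc k)" using \<alpha>0[of k] r0[of "Suc k"] by simp
    with fejer[OF that, of k] have "(norm (x (Suc k) - q))\<^sup>2 \<le> (norm (x k - q))\<^sup>2" by linarith
    then show ?thesis by (rule power2_le_imp_le) simp
  qed
  have near: "norm (x j - p k) \<le> \<delta> k" if "k \<le> j" for j k
    using that
  proof (induction rule: dec_induct)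
    case (step n)
    show ?case by (rule order_trans[OF mono1[OF p] step.IH])
  qed (simp only: \<delta>_def)
  have near2: "norm (x i - x j) \<le> 2 * \<delta> k" if "k \<le> i" "k \<le> j" for i j k
  proof -
    have "norm ((x i - p k) - (x j - p k)) \<le> norm (x i - p k) + norm (x j - p k)"
      by (rule norm_triangle_ineq4)
    then show ?thesis using near[OF that(1)] near[OF that(2)] by simp
  qed
  have "Cauchy x"
  proof (rule metric_CauchyI)
    fix e :: real assume "0 < e"
    then have "\<forall>\<^sub>F k in sequentially. \<delta> k < e / 2"
      using \<delta>_lim by (intro order_tendstoD) auto
    then obtain k where "\<delta> k < e / 2" by (auto simp: eventually_sequentially)
    then show "\<exists>M. \<forall>m\<ge>M. \<forall>n\<ge>M. dist (x m) (x n) < e"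
      using near2[of k] by (intro exI[of _ k]) (fastforce simp: dist_norm)
  qed
  then obtain xs where xs: "x \<longlonglongrightarrow> xs" unfolding Cauchy_convergent_iff convergent_def by blast
  have "(\<lambda>k. x k - p k) \<longlonglongrightarrow> 0"
    using \<delta>_lim unfolding \<delta>_def by (rule tendsto_norm_zero_cancel)
  from tendsto_diff[OF xs this] have "p \<longlonglongrightarrow> xs" by simp
  then have xsX: "xs \<in> X" using closed_sequentially[OF X, of p xs] p by blast
  have xs_r: "\<gamma> / 4 * (norm (x k - xs))\<^sup>2 \<le> r k" for k
  proof -
    have "(\<lambda>j. norm (x k - x j)) \<longlonglongrightarrow> norm (x k - xs)"
      by (intro tendsto_intros xs)
    then have "norm (x k - xs) \<le> 2 * \<delta> k"
      by (rule LIMSEQ_le_const2) (use near2[of k k] in auto)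
    then have "(norm (x k - xs))\<^sup>2 \<le> (2 * \<delta> k)\<^sup>2" by (rule power_mono) simp
    then have "\<gamma> * (norm (x k - xs))\<^sup>2 \<le> \<gamma> * (2 * \<delta> k)\<^sup>2"
      using \<gamma> by (intro mult_left_mono) auto
    then show ?thesis using gr[of k] by (simp add: \<delta>_def power_mult_distrib)
  qed
  define q where "q = sqrt (1 + a * \<gamma> / 2)"
  have q: "1 < q" "q\<^sup>2 = 1 + a * \<gamma> / 2"
    using a \<gamma> by (auto simp: q_def add_nonneg_nonneg)
  have "norm (x (Suc k) - xs) \<le> 1 / q * norm (x k - xs)" for k
  proof -
    let ?n = "(norm (x (Suc k) - xs))\<^sup>2"
    have "a * (\<gamma> / 4 * ?n) \<le> \<alpha> k * r (Suc k)"
      using a(1) a(2)[of k] \<gamma> xs_r[of "Suc k"] \<alpha>0[of k] by (intro mult_mono) auto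
    then have "q\<^sup>2 * ?n \<le> (norm (x k - xs))\<^sup>2"
      using fejer[OF xsX, of k] by (simp add: q algebra_simps)
    then have "(q * norm (x (Suc k) - xs))\<^sup>2 \<le> (norm (x k - xs))\<^sup>2"
      by (simp add: power_mult_distrib)
    then have "q * norm (x (Suc k) - xs) \<le> norm (x k - xs)"
      by (rule power2_le_imp_le) simp
    then show ?thesis using q by (simp add: field_simps)
  qed
  then have "Q_linearly_convergent x xs"
    using q unfolding Q_linearly_convergent_def by (intro exI[of _ "1 / q"] exI[of _ 0]) auto
  then show ?thesis using xsX Qr that by blast
qed

section \<open>Projected gradient steps and backtracking\<close>

text \<open>The variational inequality of the projection replaces \<open>g \<bullet> (p - z)\<close> by
  \<open>(x - p) \<bullet> (p - z) / \<alpha>\<close>, and the polarization identity does the rest. Only two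
  inequalities about the function enter, so its values are plain real numbers here.\<close>

lemma projected_gradient_three_point:
  fixes x z g :: "'a::euclidean_space"
  assumes C: "convex C" "closed C" and \<alpha>: "0 < \<alpha>" and z: "z \<in> C"
    and p: "p = closest_point C (x - \<alpha> *\<^sub>R g)"
    and upper: "fp \<le> fx + g \<bullet> (p - x) + 1 / (2 * \<alpha>) * (norm (x - p))\<^sup>2"
    and lower: "fx + g \<bullet> (z - x) \<le> fz"
  shows "2 * \<alpha> * (fp - fz) \<le> (norm (x - z))\<^sup>2 - (norm (p - z))\<^sup>2"
proof -
  have "(x - \<alpha> *\<^sub>R g - p) \<bullet> (z - p) \<le> 0"
    unfolding p by (rule closest_point_dot[OF C z])
  then have "\<alpha> * (g \<bullet> (p - z)) \<le> (x - p) \<bullet> (p - z)"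
    by (simp add: inner_diff algebra_simps)
  moreover have "fp - fz \<le> g \<bullet> (p - z) + 1 / (2 * \<alpha>) * (norm (x - p))\<^sup>2"
    using upper lower by (simp add: inner_diff)
  then have "2 * \<alpha> * (fp - fz) \<le> 2 * \<alpha> * (g \<bullet> (p - z) + 1 / (2 * \<alpha>) * (norm (x - p))\<^sup>2)"
    using \<alpha> by (intro mult_left_mono) auto
  then have "2 * \<alpha> * (fp - fz) \<le> 2 * (\<alpha> * (g \<bullet> (p - z))) + (norm (x - p))\<^sup>2"
    using \<alpha> by (simp add: algebra_simps)
  moreover have "2 * ((x - p) \<bullet> (p - z)) + (norm (x - p))\<^sup>2 = (norm (x - z))\<^sup>2 - (norm (p - z))\<^sup>2"
    by (simp add: power2_norm_eq_inner inner_diff inner_commute algebra_simps)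
  ultimately show ?thesis by linarith
qed

text \<open>The loop multiplies by \<open>\<theta>\<close> only at values above \<open>t\<^sub>0\<close>, so it never
  produces one below \<open>\<theta> * t\<^sub>0\<close>; it stops because the powers of \<open>\<theta>\<close> tend to zero.\<close>

lemma while_backtracking:
  fixes s \<theta> t\<^sub>0 :: real
  assumes \<theta>: "0 < \<theta>" "\<theta> < 1" and pos: "0 < s" "0 < t\<^sub>0"
    and stop: "\<And>t. 0 < t \<Longrightarrow> t \<le> t\<^sub>0 \<Longrightarrow> \<not> P t"
  shows "\<not> P (while P (\<lambda>t. \<theta> * t) s)"
    and "min s (\<theta> * t\<^sub>0) \<le> while P (\<lambda>t. \<theta> * t) s"
proof -
  have pow: "((\<lambda>t. \<theta> * t) ^^ k) s = \<theta> ^ k * s" for k by (induction k) auto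
  obtain k where "\<theta> ^ k < t\<^sub>0 / s"
    using real_arch_pow_inv[of "t\<^sub>0 / s" \<theta>] pos \<theta> by auto
  then have "\<not> P (((\<lambda>t. \<theta> * t) ^^ k) s)"
    unfolding pow using \<theta> pos by (intro stop) (auto simp: field_simps)
  then have "while_option P (\<lambda>t. \<theta> * t) s \<noteq> None"
    by (auto simp: while_option_def)
  then obtain t where t: "while_option P (\<lambda>t. \<theta> * t) s = Some t" by blast
  then have w: "while P (\<lambda>t. \<theta> * t) s = t" by (simp add: while_def)
  show "\<not> P (while P (\<lambda>t. \<theta> * t) s)"
    unfolding w by (rule while_option_stop[OF t])
  have "min s (\<theta> * t\<^sub>0) \<le> t"
  proof (rule while_option_rule[OF _ t])
    fix u assume u: "min s (\<theta> * t\<^sub>0) \<le> u" "P u"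
    have "0 < min s (\<theta> * t\<^sub>0)" using \<theta> pos by simp
    then have "t\<^sub>0 < u" using stop[of u] u by force
    then have "\<theta> * t\<^sub>0 \<le> \<theta> * u" using \<theta> by simp
    then show "min s (\<theta> * t\<^sub>0) \<le> \<theta> * u" by simp
  qed simp
  then show "min s (\<theta> * t\<^sub>0) \<le> while P (\<lambda>t. \<theta> * t) s" by (simp only: w)
qed

section \<open>The Poisson objective\<close>

definition poisson_grad :: "real ^ 'n ^ 'm \<Rightarrow> real ^ 'm \<Rightarrow> real ^ 'n \<Rightarrow> real ^ 'n" where
  "poisson_grad A b x = (\<Sum>i\<in>UNIV. (1 - b $ i / (row i A \<bullet> x)) *\<^sub>R row i A)"

lemma row_inner: "row i A \<bullet> x = (A *v x) $ i"
  by (simp add: row_def matrix_vector_mult_def inner_vec_def)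

lemma poisson_grad_inner: "poisson_grad A b x \<bullet> d = kl_grad b (A *v x) \<bullet> (A *v d)"
  by (simp add: poisson_grad_def kl_grad_def inner_sum_left inner_vec_def[of "vec_lambda _"] row_inner)

lemma poisson_f_eq: "A *v x \<in> pos_orthant \<Longrightarrow> poisson_f A b x = ereal (kl_div b (A *v x))"
  by (simp add: poisson_f_def kl_fn_eq)

lemma gradient_poisson:
  fixes A :: "real ^ 'n ^ 'm"
  assumes b: "b \<in> pos_orthant" and x: "A *v x \<in> pos_orthant"
  shows "gradient (poisson_f A b) x = poisson_grad A b x"
proof -
  have lin: "((\<lambda>z. (A *v z) $ i) has_derivative (\<lambda>h. (A *v h) $ i)) (at x)" for i
    unfolding row_inner[symmetric] by (auto intro!: derivative_eq_intros)
  have "((\<lambda>t. b $ i * ln (b $ i / t) + t - b $ i) has_real_derivative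
      (1 - b $ i / (A *v x) $ i)) (at ((A *v x) $ i))" for i
  proof -
    have "0 < b $ i" "0 < (A *v x) $ i" using b x by (auto simp: pos_orthant_def)
    then show ?thesis by (auto intro!: derivative_eq_intros simp: field_simps power2_eq_square)
  qed
  from DERIV_compose_FDERIV[OF this lin]
  have "((\<lambda>z. kl_div b (A *v z)) has_derivative
      (\<lambda>h. \<Sum>i\<in>UNIV. (A *v h) $ i * (1 - b $ i / (A *v x) $ i))) (at x)"
    unfolding kl_div_def by (intro has_derivative_sum)
  moreover have "(\<Sum>i\<in>UNIV. (A *v h) $ i * (1 - b $ i / (A *v x) $ i)) = h \<bullet> poisson_grad A b x" for h
    by (simp add: poisson_grad_def inner_sum_right row_inner inner_commute[of h] mult.commute)
  ultimately have D: "GDERIV (\<lambda>z. kl_div b (A *v z)) x :> poisson_grad A b x"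
    by (simp add: gderiv_def)
  have "{z. A *v z \<in> pos_orthant} = (\<Inter>i. {z. 0 < row i A \<bullet> z})"
    by (auto simp: pos_orthant_def row_inner)
  moreover have "open (\<Inter>i. {z. 0 < row i A \<bullet> z})"
    by (intro open_INT ballI open_Collect_less continuous_intros) simp
  ultimately have "open {z. A *v z \<in> pos_orthant}" by simp
  with D have G: "GDERIV (\<lambda>z. real_of_ereal (poisson_f A b z)) x :> poisson_grad A b x"
    unfolding gderiv_def
    by (rule has_derivative_transform_within_open) (use x in \<open>auto simp: poisson_f_eq\<close>)
  show ?thesis
    unfolding gradient_def
  proof (rule the_equality, rule G)
    fix D assume "GDERIV (\<lambda>z. real_of_ereal (poisson_f A b z)) x :> D"
    from has_derivative_unique[OF this[unfolded gderiv_def] G[unfolded gderiv_def]]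
    have "h \<bullet> D = h \<bullet> poisson_grad A b x" for h by metis
    then show "D = poisson_grad A b x" by (metis vector_eq_ldot)
  qed
qed

lemma nonneg_orthant_closed: "closed (nonneg_orthant :: (real ^ 'n) set)"
  unfolding nonneg_orthant_def by (intro closed_Collect_all closed_Collect_le continuous_intros)

lemma nonneg_orthant_convex: "convex (nonneg_orthant :: (real ^ 'n) set)"
  by (auto simp: nonneg_orthant_def convex_def)

lemma zero_in_nonneg_orthant: "0 \<in> nonneg_orthant"
  by (simp add: nonneg_orthant_def)

text \<open>On a sublevel set the coordinates of \<open>A *v x\<close> are at least some \<open>c > 0\<close> and
  the gradient is bounded by \<open>G\<close>. A short step therefore keeps the coordinates above
  \<open>c / 2\<close>, where the objective has a quadratic upper model with one constant \<open>L\<close>.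
  This makes the threshold for the step size uniform, although the gradient is not globally
  Lipschitz.\<close>

lemma poisson_sufficient_decrease:
  fixes A :: "real ^ 'n ^ 'm"
  assumes b: "b \<in> pos_orthant"
  obtains t\<^sub>0 where "0 < t\<^sub>0"
    "\<And>x t p. \<lbrakk>x \<in> nonneg_orthant; A *v x \<in> pos_orthant; kl_div b (A *v x) \<le> R; 0 < t; t \<le> t\<^sub>0;
        p = closest_point nonneg_orthant (x - t *\<^sub>R poisson_grad A b x)\<rbrakk> \<Longrightarrow>
      A *v p \<in> pos_orthant \<and>
      kl_div b (A *v p) \<le> kl_div b (A *v x) + poisson_grad A b x \<bullet> (p - x)
         + 1 / (2 * t) * (norm (x - p))\<^sup>2"
proof -
  obtain c M where c: "0 < c" and
    box: "\<And>y i. y \<in> pos_orthant \<Longrightarrow> kl_div b y \<le> R \<Longrightarrow> c \<le> y $ i \<and> y $ i \<le> M"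
    using kl_sublevel_box[OF b] by metis
  obtain B where B: "0 < B" "\<And>d. norm (A *v d) \<le> B * norm d"
    using linear_bounded_pos[OF matrix_vector_mul_linear[of A]] by metis
  define G where "G = (\<Sum>i\<in>UNIV. (1 + b $ i / c) * norm (row i A)) + 1"
  have G: "0 < G"
    unfolding G_def using b c
    by (intro add_nonneg_pos sum_nonneg mult_nonneg_nonneg) (auto simp: pos_orthant_def less_imp_le)
  define L where "L = norm b / (c / 2)\<^sup>2 * B\<^sup>2 + 1"
  have L: "0 < L" using B c by (simp add: L_def add_nonneg_pos)
  define t\<^sub>0 where "t\<^sub>0 = min (c / (2 * B * G)) (1 / (2 * L))"
  have "0 < t\<^sub>0" using B c G L by (simp add: t\<^sub>0_def)
  moreover have "A *v p \<in> pos_orthant \<and>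
      kl_div b (A *v p) \<le> kl_div b (A *v x) + poisson_grad A b x \<bullet> (p - x)
         + 1 / (2 * t) * (norm (x - p))\<^sup>2"
    if x: "x \<in> nonneg_orthant" "A *v x \<in> pos_orthant" "kl_div b (A *v x) \<le> R"
      and t: "0 < t" "t \<le> t\<^sub>0"
      and p: "p = closest_point nonneg_orthant (x - t *\<^sub>R poisson_grad A b x)" for x t p
  proof -
    have cx: "c \<le> (A *v x) $ i" for i using box[OF x(2,3)] by simp
    have "norm (poisson_grad A b x) \<le> (\<Sum>i\<in>UNIV. (1 + b $ i / c) * norm (row i A))"
      unfolding poisson_grad_def
    proof (rule sum_norm_le)
      fix i
      have bi: "0 < b $ i" using b by (simp add: pos_orthant_def)
      then have "b $ i / (A *v x) $ i \<le> b $ i / c" "0 \<le> b $ i / (A *v x) $ i"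
        using cx[of i] c by (auto intro!: divide_left_mono)
      then have "\<bar>1 - b $ i / (A *v x) $ i\<bar> \<le> 1 + b $ i / c" by linarith
      then show "norm ((1 - b $ i / (row i A \<bullet> x)) *\<^sub>R row i A) \<le> (1 + b $ i / c) * norm (row i A)"
        by (simp add: row_inner mult_right_mono)
    qed
    then have "norm (poisson_grad A b x) \<le> G" by (simp add: G_def)
    moreover have "dist p x \<le> dist (x - t *\<^sub>R poisson_grad A b x) x"
      using closest_point_lipschitz[OF nonneg_orthant_convex nonneg_orthant_closed,
          of "x - t *\<^sub>R poisson_grad A b x" x] x(1)
      unfolding p closest_point_self[OF x(1)] by blast
    ultimately have "norm (p - x) \<le> t * G"
      using t by (auto simp: dist_norm intro: order_trans[OF _ mult_left_mono])
    then have "norm (A *v (p - x)) \<le> B * (t * G)"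
      using B order_trans[OF B(2) mult_left_mono] by auto
    also have "\<dots> \<le> c / 2"
      using t B G by (simp add: t\<^sub>0_def field_simps)
    finally have near: "norm (A *v (p - x)) \<le> c / 2" .
    have cp: "c / 2 \<le> (A *v p) $ i" for i
      using component_le_norm_cart[of "A *v (p - x)" i] near cx[of i]
      by (simp add: matrix_vector_mult_diff_distrib)
    have pos: "A *v p \<in> pos_orthant"
      using cp c unfolding pos_orthant_def by (smt (verit) half_gt_zero mem_Collect_eq)
    have "kl_div b (A *v p) \<le> kl_div b (A *v x) + kl_grad b (A *v x) \<bullet> (A *v p - A *v x)
        + norm b / (c / 2)\<^sup>2 * (norm (A *v p - A *v x))\<^sup>2"
    proof (rule kl_descent[OF b x(2) pos _ _ cp])
      show "c / 2 \<le> (A *v x) $ i" for i using cx[of i] c by linarith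
    qed (use c in simp)
    also have "A *v p - A *v x = A *v (p - x)" by (simp add: matrix_vector_mult_diff_distrib)
    also have "norm b / (c / 2)\<^sup>2 * (norm (A *v (p - x)))\<^sup>2 \<le> norm b / (c / 2)\<^sup>2 * (B * norm (p - x))\<^sup>2"
      by (intro mult_left_mono power_mono B) auto
    also have "\<dots> = norm b / (c / 2)\<^sup>2 * B\<^sup>2 * (norm (x - p))\<^sup>2"
      by (simp add: power_mult_distrib norm_minus_commute)
    also have "\<dots> \<le> L * (norm (x - p))\<^sup>2"
      by (intro mult_right_mono) (auto simp: L_def)
    also have "L * (norm (x - p))\<^sup>2 \<le> 1 / (2 * t) * (norm (x - p))\<^sup>2"
      using t L by (intro mult_right_mono) (auto simp: t\<^sub>0_def field_simps)
    finally show ?thesis using pos by (simp add: poisson_grad_inner)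
  qed
  ultimately show ?thesis by (rule that)
qed

text \<open>The exit test of the loop has a finite right-hand side, so passing it also certifies
  that the new iterate lies in the domain of the objective.\<close>

lemma poisson_line_search_step:
  fixes A :: "real ^ 'n ^ 'm"
  assumes b: "b \<in> pos_orthant" and \<theta>: "0 < \<theta>" "\<theta> < 1"
  obtains t\<^sub>0 where "0 < t\<^sub>0"
    "\<And>x s t p. \<lbrakk>x \<in> nonneg_orthant; A *v x \<in> pos_orthant; kl_div b (A *v x) \<le> R; 0 < s;
        t = bt_linesearch (poisson_f A b) nonneg_orthant x s \<theta>;
        p = closest_point nonneg_orthant (x - t *\<^sub>R poisson_grad A b x)\<rbrakk> \<Longrightarrow>
      min s t\<^sub>0 \<le> t \<and> A *v p \<in> pos_orthant \<and>
      kl_div b (A *v p) \<le> kl_div b (A *v x) + poisson_grad A b x \<bullet> (p - x)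
         + 1 / (2 * t) * (norm (x - p))\<^sup>2"
proof -
  obtain t\<^sub>1 where t1: "0 < t\<^sub>1" and dec:
    "\<And>x t p. \<lbrakk>x \<in> nonneg_orthant; A *v x \<in> pos_orthant; kl_div b (A *v x) \<le> R; 0 < t; t \<le> t\<^sub>1;
        p = closest_point nonneg_orthant (x - t *\<^sub>R poisson_grad A b x)\<rbrakk> \<Longrightarrow>
      A *v p \<in> pos_orthant \<and>
      kl_div b (A *v p) \<le> kl_div b (A *v x) + poisson_grad A b x \<bullet> (p - x)
         + 1 / (2 * t) * (norm (x - p))\<^sup>2"
    using poisson_sufficient_decrease[OF b, of A R] by blast
  have "0 < \<theta> * t\<^sub>1" using \<theta> t1 by simp
  moreover have "min s (\<theta> * t\<^sub>1) \<le> t \<and> A *v p \<in> pos_orthant \<and>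
      kl_div b (A *v p) \<le> kl_div b (A *v x) + poisson_grad A b x \<bullet> (p - x)
         + 1 / (2 * t) * (norm (x - p))\<^sup>2"
    if x: "x \<in> nonneg_orthant" "A *v x \<in> pos_orthant" "kl_div b (A *v x) \<le> R" and s: "0 < s"
      and t: "t = bt_linesearch (poisson_f A b) nonneg_orthant x s \<theta>"
      and p: "p = closest_point nonneg_orthant (x - t *\<^sub>R poisson_grad A b x)" for x s t p
  proof -
    define J where "J u = closest_point nonneg_orthant (x - u *\<^sub>R poisson_grad A b x)" for u
    define Q where "Q u = kl_div b (A *v x) + poisson_grad A b x \<bullet> (J u - x)
         + 1 / (2 * u) * (norm (x - J u))\<^sup>2" for u
    define P where "P u \<longleftrightarrow> ereal (Q u) < poisson_f A b (J u)" for u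
    have t': "t = while P (\<lambda>u. \<theta> * u) s"
      unfolding t bt_linesearch_def pg_step_def gradient_poisson[OF b x(2)] P_def Q_def J_def
        poisson_f_eq[OF x(2)] by (simp add: add.assoc)
    have "\<not> P u" if "0 < u" "u \<le> t\<^sub>1" for u
      using dec[OF x that J_def] by (simp add: P_def Q_def poisson_f_eq)
    from while_backtracking[of \<theta> s t\<^sub>1 P, OF \<theta> s t1 this]
    have "\<not> P t" and m: "min s (\<theta> * t\<^sub>1) \<le> t" by (simp_all add: t')
    then have le: "poisson_f A b p \<le> ereal (Q t)" by (simp add: P_def J_def p)
    then have pos: "A *v p \<in> pos_orthant"
      by (auto simp: poisson_f_def kl_fn_def split: if_splits)
    with le m show ?thesis by (simp add: poisson_f_eq Q_def J_def p)
  qed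
  ultimately show ?thesis by (rule that)
qed

text \<open>Sublevel sets may be unbounded in \<open>x\<close>, but the divergence depends on \<open>A *v x\<close>
  only, which is bounded there. By the error bound, compared with the point 0, every value
  \<open>A *v x\<close> with \<open>x \<ge> 0\<close> is attained at a nonnegative point of norm at most a multiple of the norm of
  \<open>A *v x\<close>; so the minimum may be sought on the compact set \<open>K\<close>. Growth follows by
  applying strong convexity at the midpoint of \<open>z\<close> and the minimizer \<open>w\<close>: the two
  gradient terms cancel, and the midpoint is no better than \<open>w\<close>.\<close>

lemma poisson_minimizer_growth:
  fixes A :: "real ^ 'n ^ 'm"
  assumes b: "b \<in> pos_orthant" and x0: "x\<^sub>0 \<in> nonneg_orthant" "A *v x\<^sub>0 \<in> pos_orthant"
  obtains w \<mu> where "w \<in> nonneg_orthant" "A *v w \<in> pos_orthant" "0 < \<mu>"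
    "\<And>z. z \<in> nonneg_orthant \<Longrightarrow> A *v z \<in> pos_orthant \<Longrightarrow> kl_div b (A *v w) \<le> kl_div b (A *v z)"
    "\<And>z. z \<in> nonneg_orthant \<Longrightarrow> A *v z \<in> pos_orthant \<Longrightarrow> kl_div b (A *v z) \<le> kl_div b (A *v x\<^sub>0) \<Longrightarrow>
       \<mu> * (norm (A *v z - A *v w))\<^sup>2 \<le> kl_div b (A *v z) - kl_div b (A *v w)"
proof -
  define R where "R = kl_div b (A *v x\<^sub>0)"
  obtain c M where c: "0 < c" "0 < M" and
    box: "\<And>y i. y \<in> pos_orthant \<Longrightarrow> kl_div b y \<le> R \<Longrightarrow> c \<le> y $ i \<and> y $ i \<le> M"
    using kl_sublevel_box[OF b] by metis
  obtain \<kappa> where \<kappa>: "0 \<le> \<kappa>" and hoff: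
    "\<And>x z. x \<in> nonneg_orthant \<Longrightarrow> z \<in> nonneg_orthant \<Longrightarrow>
       \<exists>p\<in>nonneg_orthant. A *v p = A *v z \<and> norm (x - p) \<le> \<kappa> * norm (A *v x - A *v z)"
    using hoffman_nonneg[of A] by metis
  define D where "D = \<kappa> * (\<Sum>i\<in>(UNIV::'m set). M)"
  define K where "K = nonneg_orthant \<inter> {z. \<forall>i. c \<le> (A *v z) $ i} \<inter> cball 0 D"
  have lift: "\<exists>p\<in>K. A *v p = A *v z"
    if z: "z \<in> nonneg_orthant" "A *v z \<in> pos_orthant" "kl_div b (A *v z) \<le> R" for z
  proof -
    obtain p where p: "p \<in> nonneg_orthant" "A *v p = A *v z" "norm (0 - p) \<le> \<kappa> * norm (A *v 0 - A *v z)"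
      using hoff[OF zero_in_nonneg_orthant z(1)] by blast
    have "norm (A *v z) \<le> (\<Sum>i\<in>UNIV. \<bar>(A *v z) $ i\<bar>)" by (rule norm_le_l1_cart)
    also have "\<dots> \<le> (\<Sum>i\<in>(UNIV::'m set). M)"
      using box[OF z(2,3)] c by (intro sum_mono) (smt (verit))
    finally have "\<kappa> * norm (A *v z) \<le> D" unfolding D_def by (intro mult_left_mono \<kappa>)
    with p box[OF z(2,3)] show ?thesis by (auto simp: K_def)
  qed
  have Kpos: "A *v z \<in> pos_orthant" if "z \<in> K" for z
    using that c by (auto simp: K_def pos_orthant_def intro: less_le_trans)
  have "closed {z. \<forall>i. c \<le> (A *v z) $ i}"
    unfolding row_inner[symmetric] by (intro closed_Collect_all closed_Collect_le continuous_intros)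
  then have "compact K"
    unfolding K_def by (intro closed_Int_compact closed_Int nonneg_orthant_closed) auto
  moreover have "K \<noteq> {}" using lift[of x\<^sub>0] x0 by (auto simp: R_def)
  moreover have "continuous_on K (\<lambda>z. kl_div b (A *v z))"
  proof -
    have "(A *v z) $ i \<noteq> 0" "b $ i \<noteq> 0" if "z \<in> K" for z i
      using Kpos[OF that] b unfolding pos_orthant_def by (auto dest: spec[of _ i])
    then show ?thesis
      unfolding kl_div_def row_inner[symmetric] by (intro continuous_intros) auto
  qed
  ultimately obtain w where w: "w \<in> K" and wmin: "\<And>z. z \<in> K \<Longrightarrow> kl_div b (A *v w) \<le> kl_div b (A *v z)"
    using continuous_attains_inf[of K "\<lambda>z. kl_div b (A *v z)"] by blast
  have wC: "w \<in> nonneg_orthant" and wpos: "A *v w \<in> pos_orthant"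
    using w Kpos by (auto simp: K_def)
  have wR: "kl_div b (A *v w) \<le> R"
    using lift[of x\<^sub>0] x0 wmin by (force simp: R_def)
  have opt: "kl_div b (A *v w) \<le> kl_div b (A *v z)"
    if z: "z \<in> nonneg_orthant" "A *v z \<in> pos_orthant" for z
  proof (cases "kl_div b (A *v z) \<le> R")
    case True
    then show ?thesis using lift[OF z True] wmin by force
  qed (use wR in linarith)
  define \<mu> where "\<mu> = Min (range (\<lambda>i. b $ i / (4 * M\<^sup>2)))"
  have \<mu>: "0 < \<mu>" using b c by (auto simp: \<mu>_def pos_orthant_def)
  have \<mu>_le: "\<mu> \<le> b $ i / (4 * M\<^sup>2)" for i
    unfolding \<mu>_def by (rule Min_le) auto
  have "\<mu> / 2 * (norm (A *v z - A *v w))\<^sup>2 \<le> kl_div b (A *v z) - kl_div b (A *v w)"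
    if z: "z \<in> nonneg_orthant" "A *v z \<in> pos_orthant" "kl_div b (A *v z) \<le> R" for z
  proof -
    define v where "v = (1 / 2) *\<^sub>R (z + w)"
    define y where "y = A *v v"
    have y: "y = (1 / 2) *\<^sub>R (A *v z + A *v w)"
      by (simp add: y_def v_def matrix_vector_mult_scaleR matrix_vector_right_distrib)
    have ypos: "y \<in> pos_orthant"
      using z(2) wpos unfolding y pos_orthant_def by (simp add: add_pos_pos)
    have zM: "(A *v z) $ i \<le> M" and wM: "(A *v w) $ i \<le> M" for i
      using box[OF z(2,3)] box[OF wpos wR] by auto
    then have yM: "y $ i \<le> M" for i
      unfolding y using add_mono[OF zM[of i] wM[of i]] by simp
    have "v \<in> nonneg_orthant"
      using z(1) wC by (simp add: v_def nonneg_orthant_def)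
    then have "kl_div b (A *v w) \<le> kl_div b y"
      using ypos opt[of v] by (simp add: y_def)
    moreover have "kl_div b y + kl_grad b y \<bullet> (A *v z - y) + \<mu> * (norm (A *v z - y))\<^sup>2 \<le> kl_div b (A *v z)"
      by (intro kl_strongly_convex[OF b ypos z(2) yM zM] \<mu>_le)
    moreover have "kl_div b y + kl_grad b y \<bullet> (A *v w - y) + \<mu> * (norm (A *v w - y))\<^sup>2 \<le> kl_div b (A *v w)"
      by (intro kl_strongly_convex[OF b ypos wpos yM wM] \<mu>_le)
    moreover have dz: "A *v z - y = (1 / 2) *\<^sub>R (A *v z - A *v w)"
      and dw: "A *v w - y = - ((1 / 2) *\<^sub>R (A *v z - A *v w))"
      by (simp_all add: y vec_eq_iff field_simps)
    ultimately show ?thesis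
      unfolding dz dw by (simp add: power_mult_distrib power_divide)
  qed
  moreover have "0 < \<mu> / 2" using \<mu> by simp
  ultimately show ?thesis using wC wpos opt that unfolding R_def by blast
qed

theorem corollary5p2:
  fixes A :: "real ^ 'n ^ 'm" and b :: "real ^ 'm"
    and x :: "nat \<Rightarrow> real ^ 'n" and \<alpha> :: "nat \<Rightarrow> real" and \<sigma> \<theta> :: real
  assumes A_nonneg: "\<And>i j. 0 \<le> A $ i $ j"
    and A_rows: "\<And>i. row i A \<noteq> 0"
    and b_pos: "b \<in> pos_orthant"
    and sigma: "0 < \<sigma>"
    and theta: "0 < \<theta>" "\<theta> < 1"
    and x0: "x 0 \<in> ((*v) A -` pos_orthant) \<inter> nonneg_orthant"
    and step_0: "\<alpha> 0 = bt_linesearch (poisson_f A b) nonneg_orthant (x 0) \<sigma> \<theta>"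
    and step_Suc: "\<And>k. \<alpha> (Suc k) =
          bt_linesearch (poisson_f A b) nonneg_orthant (x (Suc k)) (\<alpha> k) \<theta>"
    and x_Suc: "\<And>k. x (Suc k) = closest_point nonneg_orthant
          (x k - \<alpha> k *\<^sub>R (\<Sum>i\<in>UNIV. (1 - b $ i / (row i A \<bullet> x k)) *\<^sub>R row i A))"
  shows "\<exists>xs F Fs. (\<forall>z. poisson_F A b xs \<le> poisson_F A b z)
           \<and> Q_linearly_convergent x xs
           \<and> (\<forall>k. poisson_F A b (x k) = ereal (F k))
           \<and> (INF z. poisson_F A b z) = ereal Fs
           \<and> Q_linearly_convergent F Fs"
proof -
  let ?C = "nonneg_orthant :: (real ^ 'n) set"
  define f where "f z = kl_div b (A *v z)" for z
  define R where "R = f (x 0)"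
  have C0: "x 0 \<in> ?C" and pos0: "A *v x 0 \<in> pos_orthant" using x0 by auto
  have xS: "x (Suc k) = closest_point ?C (x k - \<alpha> k *\<^sub>R poisson_grad A b (x k))" for k
    by (simp add: x_Suc poisson_grad_def)
  \<comment> \<open>\<open>s k\<close> is the step size at which the \<open>k\<close>-th line search starts.\<close>
  define s where "s k = (case k of 0 \<Rightarrow> \<sigma> | Suc j \<Rightarrow> \<alpha> j)" for k
  have \<alpha>: "\<alpha> k = bt_linesearch (poisson_f A b) ?C (x k) (s k) \<theta>" for k
    by (cases k) (simp_all add: s_def step_0 step_Suc)

  obtain t\<^sub>0 where t0: "0 < t\<^sub>0" and step:
    "\<And>y s t p. \<lbrakk>y \<in> ?C; A *v y \<in> pos_orthant; f y \<le> R; 0 < s;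
        t = bt_linesearch (poisson_f A b) ?C y s \<theta>;
        p = closest_point ?C (y - t *\<^sub>R poisson_grad A b y)\<rbrakk> \<Longrightarrow>
      min s t\<^sub>0 \<le> t \<and> A *v p \<in> pos_orthant \<and>
      f p \<le> f y + poisson_grad A b y \<bullet> (p - y) + 1 / (2 * t) * (norm (y - p))\<^sup>2"
    using poisson_line_search_step[OF b_pos theta, of A R] unfolding f_def by blast
  define a where "a = min \<sigma> t\<^sub>0"
  have a: "0 < a" using sigma t0 by (simp add: a_def)

  have inC: "x k \<in> ?C" for k
    using C0 closest_point_in_set[OF nonneg_orthant_closed] zero_in_nonneg_orthant
    by (cases k) (auto simp: xS)
  have onestep: "a \<le> \<alpha> k \<and> A *v x (Suc k) \<in> pos_orthant \<and>
      (\<forall>z\<in>?C. A *v z \<in> pos_orthant \<longrightarrow>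
        2 * \<alpha> k * (f (x (Suc k)) - f z) \<le> (norm (x k - z))\<^sup>2 - (norm (x (Suc k) - z))\<^sup>2)"
    if k: "A *v x k \<in> pos_orthant" "f (x k) \<le> R" "a \<le> s k" for k
  proof -
    have st: "min (s k) t\<^sub>0 \<le> \<alpha> k" "A *v x (Suc k) \<in> pos_orthant"
      and up: "f (x (Suc k)) \<le> f (x k) + poisson_grad A b (x k) \<bullet> (x (Suc k) - x k)
          + 1 / (2 * \<alpha> k) * (norm (x k - x (Suc k)))\<^sup>2"
      using step[OF inC k(1,2) _ \<alpha> xS] k(3) a by auto
    have ak: "a \<le> \<alpha> k" using st(1) k(3) by (simp add: a_def)
    have "2 * \<alpha> k * (f (x (Suc k)) - f z) \<le> (norm (x k - z))\<^sup>2 - (norm (x (Suc k) - z))\<^sup>2"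
      if z: "z \<in> ?C" "A *v z \<in> pos_orthant" for z
    proof (rule projected_gradient_three_point[OF nonneg_orthant_convex nonneg_orthant_closed _ z(1) xS up])
      show "0 < \<alpha> k" using a ak by linarith
      show "f (x k) + poisson_grad A b (x k) \<bullet> (z - x k) \<le> f z"
        using kl_convex[OF b_pos k(1) z(2)]
        by (simp add: f_def poisson_grad_inner matrix_vector_mult_diff_distrib)
    qed
    with ak st(2) show ?thesis by blast
  qed
  have inv: "A *v x k \<in> pos_orthant \<and> f (x k) \<le> R \<and> a \<le> s k" for k
  proof (induction k)
    case 0
    show ?case using pos0 by (simp add: R_def s_def a_def)
  next
    case (Suc k)
    then have k: "A *v x k \<in> pos_orthant" "f (x k) \<le> R" "a \<le> s k" by auto
    have "2 * \<alpha> k * (f (x (Suc k)) - f (x k)) \<le> 0"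
      using conjunct2[OF conjunct2[OF onestep[OF k]], rule_format, OF inC k(1)]
        zero_le_power2[of "norm (x (Suc k) - x k)"] by (simp only: diff_self norm_zero zero_power2)
    moreover have "0 < \<alpha> k" using onestep[OF k] a by linarith
    ultimately have "f (x (Suc k)) \<le> f (x k)" by (simp add: mult_le_0_iff)
    then show ?case using onestep[OF k] k by (simp add: s_def)
  qed
  have pos: "A *v x k \<in> pos_orthant" and xR: "f (x k) \<le> R" and ak: "a \<le> \<alpha> k" for k
    using inv[of k] onestep[of k] by auto
  have three: "2 * \<alpha> k * (f (x (Suc k)) - f z) \<le> (norm (x k - z))\<^sup>2 - (norm (x (Suc k) - z))\<^sup>2"
    if "z \<in> ?C" "A *v z \<in> pos_orthant" for k z
    using onestep[of k] inv[of k] that by blast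

  obtain w \<mu> where w: "w \<in> ?C" "A *v w \<in> pos_orthant" and \<mu>: "0 < \<mu>"
    and opt: "\<And>z. z \<in> ?C \<Longrightarrow> A *v z \<in> pos_orthant \<Longrightarrow> f w \<le> f z"
    and gr: "\<And>z. z \<in> ?C \<Longrightarrow> A *v z \<in> pos_orthant \<Longrightarrow> f z \<le> R \<Longrightarrow>
       \<mu> * (norm (A *v z - A *v w))\<^sup>2 \<le> f z - f w"
    using poisson_minimizer_growth[OF b_pos C0 pos0] unfolding f_def R_def by blast
  obtain \<kappa> where \<kappa>: "0 \<le> \<kappa>" and hoff:
    "\<And>x z. x \<in> ?C \<Longrightarrow> z \<in> ?C \<Longrightarrow>
       \<exists>p\<in>?C. A *v p = A *v z \<and> norm (x - p) \<le> \<kappa> * norm (A *v x - A *v z)"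
    using hoffman_nonneg[of A] by blast
  \<comment> \<open>The set of minimizers: the divergence is strictly convex, so minimizers share one
    image under \<open>A\<close>.\<close>
  define X where "X = {z \<in> ?C. A *v z = A *v w}"
  define r where "r k = f (x k) - f w" for k
  have fX: "f p = f w" if "p \<in> X" for p using that by (simp add: X_def f_def)
  have clX: "closed X"
    unfolding X_def Collect_conj_eq Collect_mem_eq
    by (intro closed_Int nonneg_orthant_closed closed_Collect_eq continuous_intros
        linear_continuous_on linear_conv_bounded_linear[THEN iffD1] matrix_vector_mul_linear)
  \<comment> \<open>\<open>\<kappa> + 1\<close> replaces \<open>\<kappa>\<close>, which may be 0, in the denominator.\<close>
  have \<gamma>: "0 < \<mu> / (\<kappa> + 1)\<^sup>2" using \<mu> \<kappa> by simp
  have growth: "\<exists>p\<in>X. \<mu> / (\<kappa> + 1)\<^sup>2 * (norm (x k - p))\<^sup>2 \<le> r k" for k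
  proof -
    obtain p where p: "p \<in> X" and d: "norm (x k - p) \<le> \<kappa> * norm (A *v x k - A *v w)"
      using hoff[OF inC w(1)] by (auto simp: X_def)
    have "norm (x k - p) \<le> (\<kappa> + 1) * norm (A *v x k - A *v w)"
      using d norm_ge_zero[of "A *v x k - A *v w"] unfolding distrib_right by linarith
    then have "(norm (x k - p))\<^sup>2 \<le> ((\<kappa> + 1) * norm (A *v x k - A *v w))\<^sup>2"
      by (rule power_mono) simp
    then have "\<mu> / (\<kappa> + 1)\<^sup>2 * (norm (x k - p))\<^sup>2
        \<le> \<mu> / (\<kappa> + 1)\<^sup>2 * ((\<kappa> + 1) * norm (A *v x k - A *v w))\<^sup>2"
      using \<mu> by (intro mult_left_mono) auto
    also have "\<dots> = \<mu> * (norm (A *v x k - A *v w))\<^sup>2"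
      using \<kappa> by (simp add: power_mult_distrib)
    also have "\<dots> \<le> r k" using gr[OF inC pos xR] by (simp add: r_def)
    finally show ?thesis using p by blast
  qed
  have fejer: "2 * \<alpha> k * r (Suc k) \<le> (norm (x k - p))\<^sup>2 - (norm (x (Suc k) - p))\<^sup>2"
    if "p \<in> X" for k p
    using three[of p k] that w(2) fX[OF that] by (simp add: r_def X_def)
  have descent: "2 * \<alpha> k * (r (Suc k) - r k) \<le> - (norm (x k - x (Suc k)))\<^sup>2" for k
    using three[OF inC pos, of k k] by (simp add: r_def norm_minus_commute)
  obtain xs where xs: "xs \<in> X" and Qx: "Q_linearly_convergent x xs"
    and Qr: "Q_linearly_convergent r 0"
    by (rule Q_linear_from_growth[of X a \<alpha> "\<mu> / (\<kappa> + 1)\<^sup>2" r x, OF clX a ak \<gamma> fejer descent growth])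

  have F_eq: "poisson_F A b z = ereal (f z)" if "z \<in> ?C" "A *v z \<in> pos_orthant" for z
    using that by (simp add: poisson_F_def poisson_f_eq indicator_fn_def f_def)
  have F_xs: "poisson_F A b xs = ereal (f w)"
    using F_eq[of xs] xs w(2) fX[OF xs] by (simp add: X_def)
  have min: "poisson_F A b xs \<le> poisson_F A b z" for z
  proof (cases "z \<in> ?C \<and> A *v z \<in> pos_orthant")
    case True
    then show ?thesis using opt[of z] by (simp add: F_xs F_eq)
  next
    case False
    then have "poisson_F A b z = \<infinity>"
      by (auto simp: poisson_F_def poisson_f_def kl_fn_def indicator_fn_def)
    then show ?thesis by simp
  qed
  then have inf: "(INF z. poisson_F A b z) = ereal (f w)"
    unfolding F_xs[symmetric] by (intro antisym INF_lower INF_greatest) auto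
  have QF: "Q_linearly_convergent (\<lambda>k. f (x k)) (f w)"
    using Qr by (simp add: Q_linearly_convergent_def r_def)
  show ?thesis
    by (intro exI conjI allI) (rule min Qx F_eq[OF inC pos] inf QF)+
qed

end
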